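(* Let $H$ be a complex Hilbert space and let $A,B\in B(H)$ be such that $AB=BA$. If $A$ is normal and $B$ is hyponormal, then $\big||A|-|B|\big|\leq |A+B|$.
   Context: $B(H)$ denotes the algebra of bounded linear operators on $H$. An operator $T\in B(H)$ is positive, $T\geq 0$, if $\langle Tx,x\rangle\geq 0$ for all $x\in H$; for self-adjoint $S,T$, $S\leq T$ means $T-S\geq 0$. For $T\in B(H)$, $|T|=\sqrt{T^*T}$ denotes the absolute value (modulus) of $T$, i.e. the unique positive square root of $T^*T$; thus $\big||A|-|B|\big|$ is the absolute value of the operator $|A|-|B|$. An operator $T$ is normal if $TT^*=T^*T$, and hyponormal if $TT^*\leq T^*T$, equivalently $\|T^*x\|\leq\|Tx\|$ for all $x\in H$. *)

theory Defs
  imports "HOL-Analysis.Analysis"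
begin

text \<open>
  A complex Hilbert space is presented over the library's real inner product spaces: the real
  inner product is the real part of the complex one, so norm, topology and completeness are
  those of \<^class>\<open>real_inner\<close> and \<^class>\<open>banach\<close>. The complex inner product is linear in its
  first argument; its positive definiteness is that of the real one (see
  \<open>cinner_self\<close> and \<open>cinner_self_eq_0_iff\<close> below).
\<close>

class complex_hilbert = real_inner + banach +
  fixes scaleC :: "complex \<Rightarrow> 'a \<Rightarrow> 'a" (infixr "*\<^sub>C" 75)
    and cinner :: "'a \<Rightarrow> 'a \<Rightarrow> complex"
  assumes scaleC_add_right: "a *\<^sub>C (x + y) = a *\<^sub>C x + a *\<^sub>C y"
    and scaleC_add_left: "(a + b) *\<^sub>C x = a *\<^sub>C x + b *\<^sub>C x"
    and scaleC_scaleC: "a *\<^sub>C b *\<^sub>C x = (a * b) *\<^sub>C x"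
    and scaleR_eq_scaleC: "scaleR r x = complex_of_real r *\<^sub>C x"
    and cinner_add_left: "cinner (x + y) z = cinner x z + cinner y z"
    and cinner_scaleC_left: "cinner (a *\<^sub>C x) y = a * cinner x y"
    and cinner_commute: "cinner x y = cnj (cinner y x)"
    and inner_eq_Re_cinner: "inner x y = Re (cinner x y)"

lemma scaleC_one: "1 *\<^sub>C x = (x :: 'a::complex_hilbert)"
  using scaleR_eq_scaleC[of 1 x] by simp

lemma cinner_self: "cinner x x = complex_of_real ((norm (x :: 'a::complex_hilbert))\<^sup>2)"
proof -
  have "Im (cinner x x) = 0"
    using arg_cong[OF cinner_commute[of x x], of Im] by simp
  then show ?thesis
    by (simp add: complex_eq_iff power2_norm_eq_inner inner_eq_Re_cinner)
qed

lemma cinner_self_eq_0_iff: "cinner x x = 0 \<longleftrightarrow> x = (0 :: 'a::complex_hilbert)"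
  by (simp add: cinner_self)

instantiation complex :: complex_hilbert
begin

definition scaleC_complex :: "complex \<Rightarrow> complex \<Rightarrow> complex"
  where "scaleC_complex a x = a * x"

definition cinner_complex :: "complex \<Rightarrow> complex \<Rightarrow> complex"
  where "cinner_complex x y = x * cnj y"

instance
  by standard
    (simp_all add: scaleC_complex_def cinner_complex_def algebra_simps scaleR_conv_of_real
      inner_complex_def)

end

text \<open>
  The library's \<^typ>\<open>'a \<Rightarrow>\<^sub>L 'a\<close> consists of the bounded real-linear operators; \<open>B(H)\<close> is the
  set of those that are moreover complex-homogeneous.
\<close>

definition BH :: "('a::complex_hilbert \<Rightarrow>\<^sub>L 'a) set" where
  "BH = {T. \<forall>a x. blinfun_apply T (a *\<^sub>C x) = a *\<^sub>C blinfun_apply T x}"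

text \<open>By the Riesz representation theorem there is exactly one such \<open>S\<close> for each \<open>T \<in> BH\<close>.\<close>

definition adj :: "('a::complex_hilbert \<Rightarrow>\<^sub>L 'a) \<Rightarrow> ('a \<Rightarrow>\<^sub>L 'a)" where
  "adj T = (THE S. S \<in> BH \<and>
     (\<forall>x y. cinner (blinfun_apply T x) y = cinner x (blinfun_apply S y)))"

definition positive_op :: "('a::complex_hilbert \<Rightarrow>\<^sub>L 'a) \<Rightarrow> bool" where
  "positive_op T \<longleftrightarrow> T \<in> BH \<and> (\<forall>x. cinner (blinfun_apply T x) x \<in> \<real>\<^sub>\<ge>\<^sub>0)"

definition le_op :: "('a::complex_hilbert \<Rightarrow>\<^sub>L 'a) \<Rightarrow> ('a \<Rightarrow>\<^sub>L 'a) \<Rightarrow> bool" (infix "\<le>\<^sub>o\<^sub>p" 50) where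
  "S \<le>\<^sub>o\<^sub>p T \<longleftrightarrow> positive_op (T - S)"

text \<open>The unique positive square root of \<open>T\<^sup>* T\<close>, for \<open>T \<in> BH\<close>.\<close>

definition abs_op :: "('a::complex_hilbert \<Rightarrow>\<^sub>L 'a) \<Rightarrow> ('a \<Rightarrow>\<^sub>L 'a)" where
  "abs_op T = (THE R. positive_op R \<and> R o\<^sub>L R = adj T o\<^sub>L T)"

definition normal_op :: "('a::complex_hilbert \<Rightarrow>\<^sub>L 'a) \<Rightarrow> bool" where
  "normal_op T \<longleftrightarrow> T o\<^sub>L adj T = adj T o\<^sub>L T"

definition hyponormal_op :: "('a::complex_hilbert \<Rightarrow>\<^sub>L 'a) \<Rightarrow> bool" where
  "hyponormal_op T \<longleftrightarrow> T o\<^sub>L adj T \<le>\<^sub>o\<^sub>p adj T o\<^sub>L T"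

end

theory Submission
  imports Defs "HOL-Complex_Analysis.Cauchy_Integral_Formula"
begin

text \<open>
  Two facts carry the proof.

  The first is a monotonicity principle (\<open>self_adjoint_le_psd\<close>): if \<open>S\<close> is self-adjoint, \<open>R\<close> is
  positive and \<open>norm (S x) \<le> norm (R x)\<close> for all \<open>x\<close>, then \<open>S \<le> R\<close>. It reduces the claim to
  \<open>norm ((|A| - |B|) x) \<le> norm ((A + B) x)\<close>, because an operator and its modulus have the same norm
  at every vector. Expanding the squares, this is
  \<open>- Re \<langle>A x, B x\<rangle> \<le> Re \<langle>|A| x, |B| x\<rangle>\<close>, that is, \<open>- Re (A\<^sup>* B) \<le> |A| |B|\<close> as an inequality
  of quadratic forms.

  The second is Fuglede's theorem: as \<open>A\<close> is normal and commutes with \<open>B\<close>, so does \<open>A\<^sup>*\<close>. Hence \<open>|A|\<close>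
  commutes with \<open>B\<close> and \<open>|B|\<close>, and \<open>|B|\<close> commutes with \<open>A\<close>; so \<open>|A| |B|\<close> is positive with
  \<open>norm (|A| |B| x) = norm (B A x)\<close>. Normality of \<open>A\<close> gives \<open>norm (A\<^sup>* B x) = norm (B A x)\<close>, and
  hyponormality of \<open>B\<close> gives \<open>norm (B\<^sup>* A x) \<le> norm (B A x)\<close>. So the real part of \<open>A\<^sup>* B\<close> is
  dominated in norm by \<open>|A| |B|\<close> at every vector, and the monotonicity principle applies once more
  (\<open>neg_inner_le_inner_abs_op\<close>).

  The modulus and the adjoint are definite descriptions, so the Riesz representation theorem
  and the existence and uniqueness of positive square roots are established as well. All estimates
  use the real inner product; complex scalars matter for positivity (\<open>positive_op_iff_psd\<close>) and for
  the Cauchy estimate behind Fuglede's theorem.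
\<close>

section \<open>Quadratic forms of self-adjoint operators\<close>

definition self_adjoint :: "('a::real_inner \<Rightarrow>\<^sub>L 'a) \<Rightarrow> bool" where
  "self_adjoint T \<longleftrightarrow> (\<forall>x y. inner (T x) y = inner x (T y))"

text \<open>
  On a complex space self-adjointness follows from positivity of the complex quadratic form; over
  the reals it has to be part of the definition (\<open>positive_op_iff_psd\<close> links the two).
\<close>

definition psd :: "('a::real_inner \<Rightarrow>\<^sub>L 'a) \<Rightarrow> bool" where
  "psd T \<longleftrightarrow> self_adjoint T \<and> (\<forall>x. 0 \<le> inner (T x) x)"

lemma self_adjointD: "self_adjoint T \<Longrightarrow> inner (T x) y = inner x (T y)"
  by (simp add: self_adjoint_def)

lemma self_adjoint_swap: "self_adjoint T \<Longrightarrow> inner (T x) y = inner (T y) x"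
  by (simp add: self_adjoint_def inner_commute)

lemma self_adjoint_diff: "self_adjoint S \<Longrightarrow> self_adjoint T \<Longrightarrow> self_adjoint (S - T)"
  by (simp add: self_adjoint_def blinfun.bilinear_simps inner_diff_left inner_diff_right)

lemma psd_self_adjoint: "psd T \<Longrightarrow> self_adjoint T"
  and psd_nonneg: "psd T \<Longrightarrow> 0 \<le> inner (T x) x"
  by (simp_all add: psd_def)

lemma psd_Cauchy_Schwarz:
  assumes "psd T"
  shows "(inner (T x) y)\<^sup>2 \<le> inner (T x) x * inner (T y) y"
proof -
  define a b d where "a = inner (T x) x" and "b = inner (T x) y" and "d = inner (T y) y"
  have a: "a \<ge> 0" and d: "d \<ge> 0"
    using assms by (simp_all add: a_def d_def psd_nonneg)
  have q: "0 \<le> a + 2 * t * b + t\<^sup>2 * d" for t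
  proof -
    have "0 \<le> inner (T (x + t *\<^sub>R y)) (x + t *\<^sub>R y)"
      by (rule psd_nonneg[OF assms])
    also have "\<dots> = a + 2 * t * b + t\<^sup>2 * d"
      using self_adjoint_swap[OF psd_self_adjoint[OF assms], of y x]
      by (simp add: a_def b_def d_def blinfun.bilinear_simps inner_add_left inner_add_right
          power2_eq_square algebra_simps)
    finally show ?thesis .
  qed
  have "b\<^sup>2 \<le> a * d"
  proof (cases "d = 0")
    case True
    have "b = 0"
    proof (rule ccontr)
      assume "b \<noteq> 0"
      then show False using q[of "- (a + 1) / (2 * b)"] True by (simp add: field_simps)
    qed
    then show ?thesis using a d by simp
  next
    case False
    have "0 \<le> d * (a + 2 * (- b / d) * b + (- b / d)\<^sup>2 * d)"
      using q[of "- b / d"] d by simp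
    also have "\<dots> = a * d - b\<^sup>2"
      using False by (simp add: field_simps power2_eq_square)
    finally show ?thesis by simp
  qed
  then show ?thesis by (simp add: a_def b_def d_def)
qed

text \<open>
  Cauchy--Schwarz for the form of \<open>T\<close> at the pair \<open>x\<close>, \<open>T x\<close>. Its use: vectors on which the form of a
  positive operator is small are almost annihilated by it.
\<close>

lemma psd_norm_apply_sq_le:
  assumes "psd T" and c: "\<And>y. inner (T y) y \<le> c * (norm y)\<^sup>2"
  shows "(norm (T x))\<^sup>2 \<le> c * inner (T x) x"
proof (cases "T x = 0")
  case True
  then show ?thesis by simp
next
  case False
  have "(norm (T x))\<^sup>2 * (norm (T x))\<^sup>2 = (inner (T x) (T x))\<^sup>2"
    by (simp only: power2_norm_eq_inner) (simp only: power2_eq_square)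
  also have "\<dots> \<le> inner (T x) x * inner (T (T x)) (T x)"
    by (rule psd_Cauchy_Schwarz[OF assms(1)])
  also have "\<dots> \<le> inner (T x) x * (c * (norm (T x))\<^sup>2)"
    by (intro mult_left_mono c psd_nonneg assms)
  finally have "(norm (T x))\<^sup>2 * (norm (T x))\<^sup>2 \<le> (c * inner (T x) x) * (norm (T x))\<^sup>2"
    by (simp add: mult_ac)
  then show ?thesis by (rule mult_right_le_imp_le) (use False in simp)
qed

lemma inner_blinfun_le:
  fixes T :: "'a::real_inner \<Rightarrow>\<^sub>L 'a"
  shows "inner (T x) x \<le> norm T * (norm x)\<^sup>2"
proof -
  have "inner (T x) x \<le> norm (T x) * norm x" by (rule norm_cauchy_schwarz)
  also have "\<dots> \<le> norm T * norm x * norm x" by (intro mult_right_mono norm_blinfun) simp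
  finally show ?thesis by (simp add: power2_eq_square)
qed

text \<open>
  A one-sided operator monotonicity of the square root: \<open>S\<^sup>2 \<le> R\<^sup>2\<close> implies \<open>S \<le> R\<close>. If it fails, the
  supremum \<open>l\<close> of the form of \<open>S - R\<close> over the unit sphere is positive. Since \<open>P = l - (S - R)\<close> is
  positive and its form comes arbitrarily close to \<open>0\<close> on the unit sphere, \<open>l\<close> is an approximate
  eigenvalue: there are unit vectors \<open>u\<close> with \<open>S u\<close> as close as desired to \<open>R u + l u\<close>. But
  \<open>norm (R u + l u)\<close> exceeds \<open>norm (R u)\<close> by a fixed amount because \<open>R \<ge> 0\<close>, contradicting
  \<open>norm (S u) \<le> norm (R u)\<close>. The freedom in the sign of \<open>S\<close>
  matters: one application takes for \<open>S\<close> minus the real part of an operator.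
\<close>

lemma self_adjoint_le_psd:
  fixes S R :: "'a::real_inner \<Rightarrow>\<^sub>L 'a"
  assumes S: "self_adjoint S" and R: "psd R" and le: "\<And>x. norm (S x) \<le> norm (R x)"
  shows "inner (S x) x \<le> inner (R x) x"
proof (rule ccontr)
  define T where "T = S - R"
  assume "\<not> ?thesis"
  then have pos: "inner (T x) x > 0"
    by (simp add: T_def blinfun.bilinear_simps inner_diff_left)
  then have "x \<noteq> 0" by auto
  define Q where "Q = (\<lambda>u. inner (T u) u) ` {u. norm u = 1}"
  define l where "l = Sup Q"
  have bdd: "bdd_above Q"
    unfolding Q_def using inner_blinfun_le[of T]
    by (intro bdd_aboveI[of _ "norm T"]) (metis (mono_tags, lifting) imageE mem_Collect_eq mult_1_right power_one)
  have scale: "inner (T u) u = inner (T (u /\<^sub>R norm u)) (u /\<^sub>R norm u) * (norm u)\<^sup>2" if "u \<noteq> 0" for u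
    using that by (simp add: blinfun.bilinear_simps power2_eq_square field_simps)
  have Tl: "inner (T u) u \<le> l * (norm u)\<^sup>2" for u
  proof (cases "u = 0")
    case False
    have "inner (T (u /\<^sub>R norm u)) (u /\<^sub>R norm u) \<in> Q"
      unfolding Q_def using False by (intro imageI) simp
    then have "inner (T (u /\<^sub>R norm u)) (u /\<^sub>R norm u) \<le> l"
      unfolding l_def by (rule cSup_upper[OF _ bdd])
    then show ?thesis
      by (subst scale[OF False]) (intro mult_right_mono, auto)
  qed simp
  have l: "l > 0"
    using order_less_le_trans[OF pos Tl] by (simp add: zero_less_mult_iff)
  define P where "P = l *\<^sub>R id_blinfun - T"
  have P_app: "P u = l *\<^sub>R u - T u" for u
    by (simp add: P_def blinfun.bilinear_simps)
  have saT: "self_adjoint T"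
    unfolding T_def by (intro self_adjoint_diff S psd_self_adjoint R)
  have "psd P"
    unfolding psd_def
  proof (intro conjI allI)
    show "self_adjoint P"
      using saT by (simp add: self_adjoint_def P_app inner_diff_left inner_diff_right)
    show "0 \<le> inner (P u) u" for u
      using Tl[of u] by (simp add: P_app inner_diff_left power2_norm_eq_inner)
  qed
  \<comment> \<open>As \<open>S u = R u + l u - P u\<close>, a small \<open>P u\<close> would make \<open>norm (S u)\<close> exceed
    \<open>norm (R u)\<close>; \<open>d\<close> is the resulting lower bound for \<open>norm (P u)\<close>.\<close>
  have below: "l\<^sup>2 \<le> 2 * norm R * norm (P u) + (norm (P u))\<^sup>2" if u: "norm u = 1" for u
  proof -
    have "(norm (R u))\<^sup>2 + l\<^sup>2 \<le> (norm (R u))\<^sup>2 + 2 * l * inner (R u) u + l\<^sup>2"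
      using l psd_nonneg[OF R, of u] by simp
    also have "\<dots> = (norm (R u + l *\<^sub>R u))\<^sup>2"
      using u unfolding power2_norm_eq_inner
      by (simp add: inner_add_left inner_add_right inner_commute power2_eq_square norm_eq_1)
    also have "R u + l *\<^sub>R u = S u + P u"
      by (simp add: P_app T_def blinfun.bilinear_simps)
    also have "(norm (S u + P u))\<^sup>2 \<le> (norm (R u) + norm (P u))\<^sup>2"
      using norm_triangle_ineq[of "S u" "P u"] le[of u] by (intro power_mono) auto
    finally have "l\<^sup>2 \<le> 2 * norm (R u) * norm (P u) + (norm (P u))\<^sup>2"
      by (simp add: power2_sum)
    moreover have "norm (R u) * norm (P u) \<le> norm R * norm (P u)"
      using norm_blinfun[of R u] u by (intro mult_right_mono) auto
    ultimately show ?thesis by linarith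
  qed
  define d where "d = min 1 (l\<^sup>2 / (2 * (2 * norm R + 1)))"
  have den: "2 * norm R + 1 > 0" by (simp add: add_nonneg_pos)
  have d: "d > 0" "d \<le> 1" using l den by (auto simp: d_def)
  have dl: "(2 * norm R + 1) * d < l\<^sup>2"
  proof -
    have "(2 * norm R + 1) * d \<le> (2 * norm R + 1) * (l\<^sup>2 / (2 * (2 * norm R + 1)))"
      using den by (intro mult_left_mono) (auto simp: d_def)
    also have "\<dots> = l\<^sup>2 / 2" using den by (simp add: field_simps)
    also have "\<dots> < l\<^sup>2" using l by simp
    finally show ?thesis .
  qed
  have Pd: "norm (P u) > d" if u: "norm u = 1" for u
  proof (rule ccontr)
    assume "\<not> d < norm (P u)"
    then have a: "norm (P u) \<le> d" by simp
    have "l\<^sup>2 \<le> 2 * norm R * norm (P u) + (norm (P u))\<^sup>2" by (rule below[OF u])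
    also have "\<dots> \<le> 2 * norm R * d + d\<^sup>2"
      using a by (intro add_mono mult_left_mono power_mono) auto
    also have "\<dots> \<le> 2 * norm R * d + d"
      using d by (simp add: power2_eq_square mult_left_le)
    also have "\<dots> < l\<^sup>2" using dl by (simp add: algebra_simps)
    finally show False by simp
  qed
  \<comment> \<open>A lower bound for \<open>norm (P u)\<close> bounds the form of \<open>P\<close> below, so \<open>l\<close> is not the least upper
    bound; the \<open>+ 1\<close> in \<open>e\<close> only keeps the denominator positive.\<close>
  define e where "e = d\<^sup>2 / (norm P + 1)"
  have nP: "norm P + 1 > 0" by (simp add: add_nonneg_pos)
  have e: "e > 0" using d nP by (simp add: e_def)
  have "Q \<noteq> {}"
    unfolding Q_def using \<open>x \<noteq> 0\<close> by (auto intro!: exI[of _ "x /\<^sub>R norm x"])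
  moreover have "q \<le> l - e" if "q \<in> Q" for q
  proof -
    from that obtain u where u: "norm u = 1" and q: "q = inner (T u) u"
      unfolding Q_def by blast
    have "d\<^sup>2 \<le> (norm (P u))\<^sup>2" using Pd[OF u] d by (intro power_mono) auto
    also have "\<dots> \<le> norm P * inner (P u) u"
      by (rule psd_norm_apply_sq_le[OF \<open>psd P\<close> inner_blinfun_le])
    also have "\<dots> \<le> (norm P + 1) * inner (P u) u"
      by (intro mult_right_mono psd_nonneg[OF \<open>psd P\<close>]) simp
    finally have "e \<le> inner (P u) u"
      using nP by (simp add: e_def field_simps)
    also have "\<dots> = l - q"
      using u by (simp add: P_app q inner_diff_left norm_eq_1)
    finally show ?thesis by simp
  qed
  ultimately have "l \<le> l - e" unfolding l_def by (intro cSup_least)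
  with e show False by simp
qed

lemma self_adjoint_zero_form:
  assumes "self_adjoint D" and "\<And>x. inner (D x) x = 0"
  shows "D = 0"
proof -
  have "psd D" using assms by (simp add: psd_def)
  have "D x = 0" for x
    using psd_norm_apply_sq_le[OF \<open>psd D\<close>, of 0 x] assms(2) by simp
  then show ?thesis by (intro blinfun_eqI) simp
qed

text \<open>
  Uniqueness of the positive square root: \<open>norm (R x) = norm (S x)\<close> for all \<open>x\<close> says \<open>R\<^sup>2 = S\<^sup>2\<close>, and
  monotonicity in both directions makes the two forms agree.
\<close>

lemma psd_eqI:
  assumes R: "psd R" and S: "psd S" and eq: "\<And>x. norm (R x) = norm (S x)"
  shows "R = S"
proof -
  have "inner ((R - S) x) x = 0" for x
    using self_adjoint_le_psd[OF psd_self_adjoint[OF R] S, of x]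
      self_adjoint_le_psd[OF psd_self_adjoint[OF S] R, of x] eq
    by (simp add: blinfun.bilinear_simps inner_diff_left)
  then have "R - S = 0"
    by (intro self_adjoint_zero_form self_adjoint_diff psd_self_adjoint R S) 
  then show ?thesis by simp
qed

section \<open>Square roots of positive operators\<close>

text \<open>
  Writing \<open>R = 1 - Y\<close>, the equation \<open>R\<^sup>2 = 1 - S\<close> becomes the fixed point equation
  \<open>Y = (S + Y\<^sup>2) / 2\<close>, which is solved by iteration from \<open>0\<close>. The same iteration for the number \<open>1\<close> in
  place of \<open>S\<close> dominates it: its increments bound the norms of the increments of the operators.
\<close>

fun sqrt_iter :: "('a::real_normed_vector \<Rightarrow>\<^sub>L 'a) \<Rightarrow> nat \<Rightarrow> ('a \<Rightarrow>\<^sub>L 'a)" where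
  "sqrt_iter S 0 = 0"
| "sqrt_iter S (Suc n) = (1/2) *\<^sub>R (S + (sqrt_iter S n o\<^sub>L sqrt_iter S n))"

fun scalar_iter :: "nat \<Rightarrow> real" where
  "scalar_iter 0 = 0"
| "scalar_iter (Suc n) = (1 + (scalar_iter n)\<^sup>2) / 2"

lemma scalar_iter_bounds: "0 \<le> scalar_iter n \<and> scalar_iter n \<le> 1"
  by (induction n) (auto simp: power_le_one)

lemma norm_blinfun_compose_le:
  assumes "norm X \<le> a" and "norm Y \<le> b"
  shows "norm (X o\<^sub>L Y) \<le> a * b"
  by (rule order_trans[OF norm_blinfun_compose mult_mono])
    (use assms in \<open>auto intro: order_trans[OF norm_ge_zero]\<close>)

lemma norm_sqrt_iter_le:
  assumes "norm S \<le> 1"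
  shows "norm (sqrt_iter S n) \<le> scalar_iter n"
proof (induction n)
  case (Suc n)
  have "norm (sqrt_iter S n o\<^sub>L sqrt_iter S n) \<le> (scalar_iter n)\<^sup>2"
    unfolding power2_eq_square by (intro norm_blinfun_compose_le Suc.IH)
  then have "norm (S + (sqrt_iter S n o\<^sub>L sqrt_iter S n)) \<le> 1 + (scalar_iter n)\<^sup>2"
    using assms by (intro norm_triangle_le add_mono)
  then show ?case by simp
qed simp

text \<open>
  The increments satisfy \<open>Y\<^sup>2 - Z\<^sup>2 = Y (Y - Z) + (Y - Z) Z\<close>, also when \<open>Y\<close> and \<open>Z\<close> do not commute, and
  this identity turns norm bounds for \<open>Y\<close>, \<open>Z\<close> and \<open>Y - Z\<close> into the corresponding scalar expression.
\<close>

lemma norm_sqrt_iter_step_le: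
  assumes S: "norm S \<le> 1"
  shows "norm (sqrt_iter S (Suc n) - sqrt_iter S n) \<le> scalar_iter (Suc n) - scalar_iter n"
proof (induction n)
  case 0
  then show ?case using S by simp
next
  case (Suc n)
  define Y Z where "Y = sqrt_iter S (Suc n)" and "Z = sqrt_iter S n"
  define y z where "y = scalar_iter (Suc n)" and "z = scalar_iter n"
  have Y: "norm Y \<le> y" and Z: "norm Z \<le> z" and YZ: "norm (Y - Z) \<le> y - z"
    unfolding Y_def Z_def y_def z_def by (intro norm_sqrt_iter_le S Suc.IH)+
  have "sqrt_iter S (Suc (Suc n)) - Y = (1/2) *\<^sub>R ((Y o\<^sub>L (Y - Z)) + ((Y - Z) o\<^sub>L Z))"
  proof -
    have 1: "sqrt_iter S (Suc (Suc n)) = (1/2) *\<^sub>R (S + (Y o\<^sub>L Y))"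
      and 2: "Y = (1/2) *\<^sub>R (S + (Z o\<^sub>L Z))"
      by (simp_all only: Y_def Z_def sqrt_iter.simps)
    have "S + (Y o\<^sub>L Y) - (S + (Z o\<^sub>L Z)) = (Y o\<^sub>L (Y - Z)) + ((Y - Z) o\<^sub>L Z)"
      by (rule blinfun_eqI) (simp add: blinfun.bilinear_simps)
    then show ?thesis
      unfolding 1 by (subst (2) 2) (simp only: scaleR_diff_right [symmetric])
  qed
  moreover have "norm ((Y o\<^sub>L (Y - Z)) + ((Y - Z) o\<^sub>L Z)) \<le> y * (y - z) + (y - z) * z"
  proof (rule norm_triangle_le, rule add_mono)
    show "norm (Y o\<^sub>L (Y - Z)) \<le> y * (y - z)"
      by (intro norm_blinfun_compose_le Y YZ)
    show "norm ((Y - Z) o\<^sub>L Z) \<le> (y - z) * z"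
      by (intro norm_blinfun_compose_le YZ Z)
  qed
  ultimately have "norm (sqrt_iter S (Suc (Suc n)) - Y) \<le> (y * (y - z) + (y - z) * z) / 2"
    by simp
  also have "\<dots> = scalar_iter (Suc (Suc n)) - y"
  proof -
    have 1: "scalar_iter (Suc (Suc n)) = (1 + y\<^sup>2) / 2" and 2: "y = (1 + z\<^sup>2) / 2"
      by (simp_all only: y_def z_def scalar_iter.simps)
    have 3: "y * (y - z) + (y - z) * z = y\<^sup>2 - z\<^sup>2"
      by (simp add: power2_eq_square algebra_simps)
    have 4: "(p - q) / 2 = (1 + p) / 2 - y" if "y = (1 + q) / 2" for p q :: real
      unfolding that by (simp add: field_simps)
    show ?thesis unfolding 1 3 by (rule 4[OF 2])
  qed
  finally show ?case by (simp add: Y_def y_def)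
qed

text \<open>
  The dominating scalar increments telescope to a sequence bounded by \<open>1\<close>, so the operator increments
  are absolutely summable; this gives convergence in norm even when \<open>norm S = 1\<close>, where the
  iteration is not a strict contraction.
\<close>

lemma convergent_sqrt_iter:
  fixes S :: "'a::banach \<Rightarrow>\<^sub>L 'a"
  assumes S: "norm S \<le> 1"
  shows "convergent (sqrt_iter S)"
proof -
  define d where "d n = scalar_iter (Suc n) - scalar_iter n" for n
  have d0: "0 \<le> d n" for n
    using norm_sqrt_iter_step_le[of "0 :: real \<Rightarrow>\<^sub>L real" n] unfolding d_def
    by (smt (verit) norm_ge_zero norm_zero)
  have dsum: "(\<Sum>i<n. d i) = scalar_iter n" for n
    by (induction n) (auto simp: d_def)
  have "summable d"
  proof (rule bounded_imp_summable)
    show "(\<Sum>i\<le>n. d i) \<le> 1" for n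
      using dsum[of "Suc n"] scalar_iter_bounds[of "Suc n"]
      unfolding lessThan_Suc_atMost by simp
  qed (rule d0)
  then have "summable (\<lambda>n. sqrt_iter S (Suc n) - sqrt_iter S n)"
    by (rule summable_comparison_test'[where N = 0])
      (use norm_sqrt_iter_step_le[OF S] in \<open>auto simp: d_def\<close>)
  then have "convergent (\<lambda>n. \<Sum>i<n. sqrt_iter S (Suc i) - sqrt_iter S i)"
    by (simp add: summable_iff_convergent)
  moreover have "(\<Sum>i<n. sqrt_iter S (Suc i) - sqrt_iter S i) = sqrt_iter S n" for n
    by (subst sum_lessThan_telescope) simp
  ultimately show ?thesis by simp
qed

lemma self_adjoint_tendsto:
  assumes "X \<longlonglongrightarrow> L" and "\<And>n. self_adjoint (X n)"
  shows "self_adjoint L"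
  unfolding self_adjoint_def
proof (intro allI)
  fix x y
  have "(\<lambda>n. inner (X n x) y) \<longlonglongrightarrow> inner (L x) y"
    and "(\<lambda>n. inner x (X n y)) \<longlonglongrightarrow> inner x (L y)"
    by (intro tendsto_intros assms(1))+
  then show "inner (L x) y = inner x (L y)"
    using assms(2) by (simp add: self_adjointD LIMSEQ_unique)
qed

lemma commute_tendsto:
  fixes C L :: "'a::real_normed_vector \<Rightarrow>\<^sub>L 'a"
  assumes "X \<longlonglongrightarrow> L" and "\<And>n. C o\<^sub>L X n = X n o\<^sub>L C"
  shows "C o\<^sub>L L = L o\<^sub>L C"
proof -
  have "(\<lambda>n. C o\<^sub>L X n) \<longlonglongrightarrow> (C o\<^sub>L L)" and "(\<lambda>n. X n o\<^sub>L C) \<longlonglongrightarrow> (L o\<^sub>L C)"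
    by (intro bounded_bilinear.tendsto[OF bounded_bilinear_blinfun_compose] tendsto_const assms(1))+
  then show ?thesis using assms(2) by (simp add: LIMSEQ_unique)
qed

text \<open>
  Commutation with the commutant of \<open>T\<close> is read off from the construction: every iterate is a
  polynomial in \<open>T\<close>.
\<close>

lemma psd_contraction_sqrt:
  fixes T :: "'a::{real_inner, banach} \<Rightarrow>\<^sub>L 'a"
  assumes T: "psd T" and T1: "\<And>x. inner (T x) x \<le> (norm x)\<^sup>2"
  obtains R where "psd R" "R o\<^sub>L R = T" "\<And>C. C o\<^sub>L T = T o\<^sub>L C \<Longrightarrow> C o\<^sub>L R = R o\<^sub>L C"
proof -
  define S where "S = id_blinfun - T"
  have S_app: "S x = x - T x" for x by (simp add: S_def blinfun.bilinear_simps)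
  have saS: "self_adjoint S"
    using psd_self_adjoint[OF T] by (simp add: self_adjoint_def S_app inner_diff_left inner_diff_right)
  have "psd S"
    using saS T1 by (simp add: psd_def S_app inner_diff_left power2_norm_eq_inner)
  have "norm S \<le> 1"
  proof (rule norm_blinfun_bound)
    fix x
    have S1: "inner (S y) y \<le> 1 * (norm y)\<^sup>2" for y
      using psd_nonneg[OF T, of y] by (simp add: S_app inner_diff_left power2_norm_eq_inner)
    have "(norm (S x))\<^sup>2 \<le> 1 * inner (S x) x" by (rule psd_norm_apply_sq_le[OF \<open>psd S\<close> S1])
    also have "\<dots> \<le> (norm x)\<^sup>2" using S1[of x] by simp
    finally show "norm (S x) \<le> 1 * norm x" by (simp add: power2_le_iff_abs_le)
  qed simp
  then obtain Y where Y: "sqrt_iter S \<longlonglongrightarrow> Y"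
    using convergent_sqrt_iter by (auto simp: convergent_def)
  have fixpoint: "Y = (1/2) *\<^sub>R (S + (Y o\<^sub>L Y))"
  proof (rule LIMSEQ_unique)
    show "(\<lambda>n. sqrt_iter S (Suc n)) \<longlonglongrightarrow> Y" by (rule LIMSEQ_Suc[OF Y])
    show "(\<lambda>n. sqrt_iter S (Suc n)) \<longlonglongrightarrow> (1/2) *\<^sub>R (S + (Y o\<^sub>L Y))"
      unfolding sqrt_iter.simps
      by (intro tendsto_intros bounded_bilinear.tendsto[OF bounded_bilinear_blinfun_compose] Y)
  qed
  have "norm Y \<le> 1"
  proof (rule Lim_norm_ubound[OF sequentially_bot Y], intro always_eventually allI)
    show "norm (sqrt_iter S n) \<le> 1" for n
      using norm_sqrt_iter_le[OF \<open>norm S \<le> 1\<close>, of n] scalar_iter_bounds[of n] by linarith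
  qed
  have "self_adjoint (sqrt_iter S n)" for n
  proof (induction n)
    case (Suc n)
    then show ?case
      using saS by (simp add: self_adjoint_def blinfun.bilinear_simps inner_add_left inner_add_right)
  qed (simp add: self_adjoint_def)
  then have saY: "self_adjoint Y" by (rule self_adjoint_tendsto[OF Y])
  define R where "R = id_blinfun - Y"
  have R_app: "R x = x - Y x" for x by (simp add: R_def blinfun.bilinear_simps)
  show thesis
  proof
    show "psd R"
      unfolding psd_def
    proof (intro conjI allI)
      show "self_adjoint R"
        using saY by (simp add: self_adjoint_def R_app inner_diff_left inner_diff_right)
      fix x
      have "inner (Y x) x \<le> 1 * (norm x)\<^sup>2"
        by (rule order_trans[OF inner_blinfun_le mult_right_mono]) (use \<open>norm Y \<le> 1\<close> in auto)
      then show "0 \<le> inner (R x) x"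
        by (simp add: R_app inner_diff_left power2_norm_eq_inner)
    qed
    show "R o\<^sub>L R = T"
    proof (rule blinfun_eqI)
      fix x
      have "2 *\<^sub>R Y x = S x + Y (Y x)"
        by (subst fixpoint) (simp add: blinfun.bilinear_simps)
      then show "(R o\<^sub>L R) x = T x"
        by (simp add: R_app blinfun.bilinear_simps S_app algebra_simps scaleR_2)
    qed
    fix C assume C: "C o\<^sub>L T = T o\<^sub>L C"
    then have CT: "C (T x) = T (C x)" for x by (metis blinfun_apply_blinfun_compose)
    have "C o\<^sub>L sqrt_iter S n = sqrt_iter S n o\<^sub>L C" for n
    proof (induction n)
      case (Suc n)
      then have "C (sqrt_iter S n x) = sqrt_iter S n (C x)" for x
        by (metis blinfun_apply_blinfun_compose)
      then show ?case
        by (intro blinfun_eqI) (simp add: blinfun.bilinear_simps S_app CT)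
    qed (intro blinfun_eqI, simp add: blinfun.bilinear_simps)
    then have "C o\<^sub>L Y = Y o\<^sub>L C" by (rule commute_tendsto[OF Y])
    then have "C (Y x) = Y (C x)" for x by (metis blinfun_apply_blinfun_compose)
    then show "C o\<^sub>L R = R o\<^sub>L C"
      by (intro blinfun_eqI) (simp add: R_app blinfun.bilinear_simps)
  qed
qed

lemma psd_sqrt:
  fixes T :: "'a::{real_inner, banach} \<Rightarrow>\<^sub>L 'a"
  assumes T: "psd T"
  obtains R where "psd R" "R o\<^sub>L R = T" "\<And>C. C o\<^sub>L T = T o\<^sub>L C \<Longrightarrow> C o\<^sub>L R = R o\<^sub>L C"
proof (cases "T = 0")
  case True
  show thesis
    by (rule that[of 0]) (auto simp: True psd_def self_adjoint_def)
next
  case False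
  define c where "c = norm T"
  have c: "c > 0" using False by (simp add: c_def)
  define U where "U = (1/c) *\<^sub>R T"
  have "psd U"
    using T c by (auto simp: psd_def self_adjoint_def U_def blinfun.bilinear_simps
        intro!: divide_nonneg_pos)
  have U1: "inner (U x) x \<le> (norm x)\<^sup>2" for x
    using inner_blinfun_le[of T x] c
    by (simp add: U_def blinfun.bilinear_simps pos_divide_le_eq mult.commute flip: c_def)
  obtain V where V: "psd V" "V o\<^sub>L V = U" "\<And>C. C o\<^sub>L U = U o\<^sub>L C \<Longrightarrow> C o\<^sub>L V = V o\<^sub>L C"
    using psd_contraction_sqrt[OF \<open>psd U\<close> U1] by blast
  show thesis
  proof (rule that[of "sqrt c *\<^sub>R V"])
    show "psd (sqrt c *\<^sub>R V)"
      using V(1) c by (auto simp: psd_def self_adjoint_def blinfun.bilinear_simps)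
    have "(sqrt c *\<^sub>R V) o\<^sub>L (sqrt c *\<^sub>R V) = c *\<^sub>R (V o\<^sub>L V)"
      using c by (intro blinfun_eqI) (simp add: blinfun.bilinear_simps)
    then show "(sqrt c *\<^sub>R V) o\<^sub>L (sqrt c *\<^sub>R V) = T"
      using c by (simp add: V(2) U_def)
    fix C assume "C o\<^sub>L T = T o\<^sub>L C"
    then have "C o\<^sub>L V = V o\<^sub>L C"
      by (intro V(3)) (simp add: U_def bounded_bilinear.scaleR_left[OF bounded_bilinear_blinfun_compose]
          bounded_bilinear.scaleR_right[OF bounded_bilinear_blinfun_compose])
    then show "C o\<^sub>L sqrt c *\<^sub>R V = sqrt c *\<^sub>R V o\<^sub>L C"
      by (simp add: bounded_bilinear.scaleR_left[OF bounded_bilinear_blinfun_compose]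
          bounded_bilinear.scaleR_right[OF bounded_bilinear_blinfun_compose])
  qed
qed

text \<open>
  With \<open>V\<close> the root of \<open>Q\<close>, which commutes with \<open>P\<close>, one has \<open>P Q = V P V\<close>.
\<close>

lemma psd_compose:
  fixes P Q :: "'a::{real_inner, banach} \<Rightarrow>\<^sub>L 'a"
  assumes P: "psd P" and Q: "psd Q" and PQ: "P o\<^sub>L Q = Q o\<^sub>L P"
  shows "psd (P o\<^sub>L Q)"
proof -
  have comm: "P (Q x) = Q (P x)" for x using PQ by (metis blinfun_apply_blinfun_compose)
  obtain V where V: "psd V" "V o\<^sub>L V = Q" "P o\<^sub>L V = V o\<^sub>L P"
    using psd_sqrt[OF Q] PQ by metis
  have VV: "V (V x) = Q x" for x using V(2) by (metis blinfun_apply_blinfun_compose)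
  have PV: "P (V x) = V (P x)" for x using V(3) by (metis blinfun_apply_blinfun_compose)
  show ?thesis
    unfolding psd_def
  proof (intro conjI allI)
    show "self_adjoint (P o\<^sub>L Q)"
      using psd_self_adjoint[OF P] psd_self_adjoint[OF Q] by (simp add: self_adjoint_def comm)
    fix x
    have "inner ((P o\<^sub>L Q) x) x = inner (V (P (V x))) x"
      by (simp add: VV[symmetric] PV)
    also have "\<dots> = inner (P (V x)) (V x)"
      by (rule self_adjointD[OF psd_self_adjoint[OF V(1)]])
    finally show "0 \<le> inner ((P o\<^sub>L Q) x) x" using psd_nonneg[OF P] by simp
  qed
qed

section \<open>Riesz representation and adjoints\<close>

text \<open>
  The representing vector minimizes \<open>(norm x)\<^sup>2 - 2 * f x\<close>. A minimizing sequence is Cauchy by the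
  parallelogram law, and at a minimum the first variation \<open>inner v z - f v\<close> vanishes.
\<close>

lemma Riesz_representation:
  fixes f :: "'a::{real_inner, banach} \<Rightarrow> real"
  assumes f: "bounded_linear f"
  obtains z where "\<And>x. f x = inner x z"
proof -
  interpret f: bounded_linear f by (rule f)
  define \<phi> where "\<phi> x = (norm x)\<^sup>2 - 2 * f x" for x
  obtain K where K: "\<And>x. norm (f x) \<le> norm x * K"
    using f.bounded by blast
  have low: "- K\<^sup>2 \<le> \<phi> x" for x
  proof -
    have "f x \<le> norm x * K" using K[of x] by simp
    moreover have "0 \<le> (norm x - K)\<^sup>2" by simp
    ultimately show ?thesis by (simp add: \<phi>_def power2_diff)
  qed
  define m where "m = Inf (range \<phi>)"
  have bdd: "bdd_below (range \<phi>)" using low by (intro bdd_belowI[of _ "- K\<^sup>2"]) auto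
  have m: "m \<le> \<phi> x" for x unfolding m_def by (intro cInf_lower bdd) simp
  have "\<exists>x. \<phi> x < m + 1 / Suc n" for n
    using cInf_lessD[of "range \<phi>" "m + 1 / Suc n"] by (auto simp: m_def)
  then obtain X where X: "\<And>n. \<phi> (X n) < m + 1 / Suc n" by metis
  have para: "(norm (x - y))\<^sup>2 \<le> 2 * (\<phi> x - m) + 2 * (\<phi> y - m)" for x y
  proof -
    have "(norm (x - y))\<^sup>2 = 2 * \<phi> x + 2 * \<phi> y - 4 * \<phi> ((1/2) *\<^sub>R (x + y))"
      unfolding \<phi>_def power2_norm_eq_inner
      by (simp add: f.scaleR f.add inner_diff_left inner_diff_right
          inner_add_left inner_add_right inner_commute algebra_simps)
    then show ?thesis using m[of "(1/2) *\<^sub>R (x + y)"] by simp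
  qed
  have "Cauchy X"
  proof (rule metric_CauchyI)
    fix e :: real assume e: "e > 0"
    obtain N where N: "1 / Suc N < e\<^sup>2 / 4"
      using nat_approx_posE[of "e\<^sup>2 / 4"] e by auto
    have small: "\<phi> (X n) - m < e\<^sup>2 / 4" if "n \<ge> N" for n
    proof -
      have "1 / real (Suc n) \<le> 1 / Suc N" using that by (simp add: frac_le)
      then show ?thesis using X[of n] N by linarith
    qed
    have "dist (X k) (X n) < e" if "k \<ge> N" "n \<ge> N" for k n
    proof -
      note para[of "X k" "X n"]
      also have "2 * (\<phi> (X k) - m) + 2 * (\<phi> (X n) - m) < 2 * (e\<^sup>2 / 4) + 2 * (e\<^sup>2 / 4)"
        by (intro add_strict_mono mult_strict_left_mono small that) simp_all
      finally have "(norm (X k - X n))\<^sup>2 < e\<^sup>2" by simp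
      then show ?thesis using e by (simp add: dist_norm power2_less_imp_less)
    qed
    then show "\<exists>M. \<forall>k\<ge>M. \<forall>n\<ge>M. dist (X k) (X n) < e" by blast
  qed
  then obtain z where z: "X \<longlonglongrightarrow> z"
    using Cauchy_convergent_iff convergent_def by blast
  have "\<phi> z \<le> m"
  proof (rule LIMSEQ_le)
    show "(\<lambda>n. \<phi> (X n)) \<longlonglongrightarrow> \<phi> z"
      unfolding \<phi>_def by (intro tendsto_intros f.tendsto z)
    show "(\<lambda>n. m + 1 / Suc n) \<longlonglongrightarrow> m"
      using tendsto_add[OF tendsto_const[of m] LIMSEQ_inverse_real_of_nat]
      by (simp add: inverse_eq_divide)
    show "\<exists>N. \<forall>n\<ge>N. \<phi> (X n) \<le> m + 1 / Suc n" using X less_imp_le by blast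
  qed
  have "f v = inner v z" for v
  proof -
    define b q where "b = inner v z - f v" and "q = (norm v)\<^sup>2 + 1"
    have q: "q > 0" by (simp add: q_def add_nonneg_pos)
    \<comment> \<open>The step length minimizes the quadratic in \<open>t\<close>, up to the \<open>+ 1\<close> that covers \<open>v = 0\<close>.\<close>
    define t where "t = - b / q"
    have tq: "t * q = - b" using q by (simp add: t_def)
    have "\<phi> z \<le> \<phi> (z + t *\<^sub>R v)" using m[of "z + t *\<^sub>R v"] \<open>\<phi> z \<le> m\<close> by simp
    also have "\<dots> = \<phi> z + 2 * t * b + t\<^sup>2 * (norm v)\<^sup>2"
      unfolding \<phi>_def b_def power2_norm_eq_inner
      by (simp add: f.scaleR f.add inner_add_left inner_add_right inner_commute
          algebra_simps power2_eq_square)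
    also have "\<dots> = \<phi> z - t\<^sup>2 * q - t\<^sup>2"
    proof -
      have 1: "b = - (t * q)" and 2: "(norm v)\<^sup>2 = q - 1" using tq by (simp_all add: q_def)
      show ?thesis unfolding 1 2 by (simp add: algebra_simps power2_eq_square)
    qed
    finally have "t\<^sup>2 * q + t\<^sup>2 \<le> 0" by simp
    moreover have "0 \<le> t\<^sup>2 * q" using q by simp
    ultimately have "t\<^sup>2 \<le> 0" by linarith
    then have "t = 0" by simp
    then show ?thesis using tq by (simp add: b_def)
  qed
  then show thesis by (rule that)
qed

lemma real_adjoint_exists:
  fixes T :: "'a::{real_inner, banach} \<Rightarrow>\<^sub>L 'a"
  obtains S :: "'a \<Rightarrow>\<^sub>L 'a" where "\<And>x y. inner (T x) y = inner x (S y)"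
proof -
  have "\<exists>z. \<forall>x. inner (T x) y = inner x z" for y
  proof -
    have "bounded_linear (\<lambda>x. inner (T x) y)" by (intro bounded_linear_intros)
    then show ?thesis using Riesz_representation by metis
  qed
  then obtain s where s: "\<And>x y. inner (T x) y = inner x (s y)" by metis
  have "bounded_linear s"
  proof (rule bounded_linear_intro)
    show "s (x + y) = s x + s y" for x y
      by (subst vector_eq_ldot[symmetric]) (simp add: s[symmetric] inner_add_right)
    show "s (r *\<^sub>R x) = r *\<^sub>R s x" for r x
      by (subst vector_eq_ldot[symmetric]) (simp add: s[symmetric])
    show "norm (s y) \<le> norm y * norm T" for y
    proof (cases "s y = 0")
      case False
      have "norm (s y) * norm (s y) = inner (T (s y)) y"
        by (simp add: s power2_norm_eq_inner[symmetric] power2_eq_square)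
      also have "\<dots> \<le> norm (T (s y)) * norm y" by (rule norm_cauchy_schwarz)
      also have "\<dots> \<le> norm T * norm (s y) * norm y"
        by (intro mult_right_mono norm_blinfun) simp
      finally have "norm (s y) * norm (s y) \<le> (norm y * norm T) * norm (s y)"
        by (simp add: mult_ac)
      then show ?thesis using False by (simp add: mult_le_cancel_right)
    qed simp
  qed
  then show thesis
    using s by (intro that[of "Blinfun s"]) (simp add: bounded_linear_Blinfun_apply)
qed

section \<open>The algebra of complex-linear operators\<close>

lemma cinner_scaleC_right: "cinner x (a *\<^sub>C y) = cnj a * cinner x (y::'a::complex_hilbert)"
  by (subst (1 2) cinner_commute) (simp add: cinner_scaleC_left)

lemma scaleC_minus1: "(- 1) *\<^sub>C x = - (x::'a::complex_hilbert)"
  using scaleR_eq_scaleC[of "-1" x] by simp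

lemma cinner_diff_left: "cinner (x - y) z = cinner x z - cinner y (z::'a::complex_hilbert)"
  using cinner_add_left[of x "(-1) *\<^sub>C y" z] by (simp add: scaleC_minus1 cinner_scaleC_left[of "-1", unfolded scaleC_minus1])

lemma Im_cinner: "Im (cinner x y) = - inner (\<i> *\<^sub>C x) (y::'a::complex_hilbert)"
  by (simp add: inner_eq_Re_cinner cinner_scaleC_left)

lemma cinner_eqI:
  fixes x y u v :: "'a::complex_hilbert"
  assumes "inner x y = inner u v" "inner (\<i> *\<^sub>C x) y = inner (\<i> *\<^sub>C u) v"
  shows "cinner x y = cinner u v"
  using assms by (simp add: complex_eq_iff Im_cinner) (simp add: inner_eq_Re_cinner)

lemma norm_scaleC: "norm (a *\<^sub>C x) = cmod a * norm (x::'a::complex_hilbert)"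
proof -
  have "complex_of_real ((norm (a *\<^sub>C x))\<^sup>2) = a * cnj a * complex_of_real ((norm x)\<^sup>2)"
    unfolding cinner_self[symmetric] by (simp add: cinner_scaleC_left cinner_scaleC_right)
  also have "\<dots> = complex_of_real ((cmod a * norm x)\<^sup>2)"
    by (simp add: complex_norm_square[symmetric] power_mult_distrib)
  finally have "(norm (a *\<^sub>C x))\<^sup>2 = (cmod a * norm x)\<^sup>2" by (simp only: of_real_eq_iff)
  then show ?thesis by (simp add: power2_eq_iff_nonneg)
qed

lemma cmod_cinner_le: "cmod (cinner x y) \<le> norm x * norm (y::'a::complex_hilbert)"
proof (cases "cinner x y = 0")
  case False
  define u where "u = cnj (cinner x y) / cmod (cinner x y)"
  have "cmod u = 1" using False by (simp add: u_def norm_divide)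
  have "cmod (cinner x y) = Re (u * cinner x y)"
  proof -
    have "u * cinner x y = complex_of_real (cmod (cinner x y))"
      using False complex_norm_square[of "cinner x y"]
      by (simp add: u_def field_simps power2_eq_square)
    then show ?thesis by simp
  qed
  also have "\<dots> = inner (u *\<^sub>C x) y" by (simp add: inner_eq_Re_cinner cinner_scaleC_left)
  also have "\<dots> \<le> norm (u *\<^sub>C x) * norm y" by (rule norm_cauchy_schwarz)
  finally show ?thesis using \<open>cmod u = 1\<close> by (simp add: norm_scaleC)
qed simp

lemma BH_scaleC: "T \<in> BH \<Longrightarrow> T (a *\<^sub>C x) = a *\<^sub>C T x"
  by (simp add: BH_def)

lemma scaleC_minus_right: "a *\<^sub>C (- x) = - (a *\<^sub>C (x::'a::complex_hilbert))"
  using scaleC_scaleC[of a "-1" x] scaleC_scaleC[of "-1" a x] by (simp add: scaleC_minus1)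

lemma scaleC_diff_right: "a *\<^sub>C (x - y) = a *\<^sub>C x - a *\<^sub>C (y::'a::complex_hilbert)"
  using scaleC_add_right[of a x "- y"] by (simp add: scaleC_minus_right)

lemma BH_add: "S \<in> BH \<Longrightarrow> T \<in> BH \<Longrightarrow> S + T \<in> BH"
  and BH_diff: "S \<in> BH \<Longrightarrow> T \<in> BH \<Longrightarrow> S - T \<in> BH"
  and BH_compose: "S \<in> BH \<Longrightarrow> T \<in> BH \<Longrightarrow> S o\<^sub>L T \<in> BH"
  by (simp_all add: BH_def blinfun.bilinear_simps scaleC_add_right scaleC_diff_right)

text \<open>
  The adjoint for the real inner product is complex-linear and is the adjoint for the complex one,
  because the imaginary part of \<open>cinner x y\<close> is the real inner product of \<open>- \<i> x\<close> with \<open>y\<close>.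
\<close>

lemma adj_in_BH_and_cinner:
  fixes T :: "'a::complex_hilbert \<Rightarrow>\<^sub>L 'a"
  assumes T: "T \<in> BH"
  shows "adj T \<in> BH \<and> (\<forall>x y. cinner (T x) y = cinner x (adj T y))"
proof -
  obtain S :: "'a \<Rightarrow>\<^sub>L 'a" where S: "\<And>x y. inner (T x) y = inner x (S y)"
    using real_adjoint_exists by blast
  have cS: "cinner (T x) y = cinner x (S y)" for x y
    by (rule cinner_eqI) (simp_all add: S flip: BH_scaleC[OF T])
  have "S (a *\<^sub>C y) = a *\<^sub>C S y" for a y
  proof -
    have "cinner x (S (a *\<^sub>C y)) = cinner x (a *\<^sub>C S y)" for x
      by (simp add: cinner_scaleC_right flip: cS)
    then have "\<forall>x. inner x (S (a *\<^sub>C y)) = inner x (a *\<^sub>C S y)"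
      by (simp add: inner_eq_Re_cinner)
    then show ?thesis by (simp only: vector_eq_ldot)
  qed
  then have "S \<in> BH" by (simp add: BH_def)
  show ?thesis
    unfolding adj_def
  proof (rule theI[of _ S])
    show "S \<in> BH \<and> (\<forall>x y. cinner (T x) y = cinner x (S y))" using \<open>S \<in> BH\<close> cS by blast
    fix S' assume "S' \<in> BH \<and> (\<forall>x y. cinner (T x) y = cinner x (blinfun_apply S' y))"
    then have "inner x (S' y) = inner x (S y)" for x y
      by (metis cS inner_eq_Re_cinner)
    then show "S' = S" by (intro blinfun_eqI) (metis vector_eq_ldot)
  qed
qed

lemma adj_in_BH: "T \<in> BH \<Longrightarrow> adj T \<in> BH"
  and cinner_adj: "T \<in> BH \<Longrightarrow> cinner (T x) y = cinner x (adj T y)"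
  using adj_in_BH_and_cinner by blast+

lemma cinner_adj_left: "T \<in> BH \<Longrightarrow> cinner (adj T x) y = cinner x (T y)"
  using cinner_adj[of T y x] by (metis cinner_commute)

lemma inner_adj: "T \<in> BH \<Longrightarrow> inner (T x) y = inner x (adj T y)"
  and inner_adj_left: "T \<in> BH \<Longrightarrow> inner (adj T x) y = inner x (T y)"
  by (simp_all add: inner_eq_Re_cinner cinner_adj cinner_adj_left)

text \<open>
  The reduction of complex positivity to the real theory. Self-adjointness comes from polarization:
  the form \<open>inner (\<i> T x) x\<close> vanishes identically, and its polarization at the pair \<open>x\<close>, \<open>\<i> y\<close> is the symmetry of
  \<open>T\<close>.
\<close>

lemma positive_op_iff_psd: "positive_op T \<longleftrightarrow> T \<in> BH \<and> psd T"
proof (intro iffI conjI)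
  assume pos: "positive_op T"
  then show T: "T \<in> BH" by (simp add: positive_op_def)
  have re: "0 \<le> inner (T x) x" and im: "inner (\<i> *\<^sub>C T x) x = 0" for x
    using pos Im_cinner[of "T x" x]
    by (auto simp: positive_op_def complex_nonneg_Reals_iff inner_eq_Re_cinner)
  have "inner (T x) y = inner x (T y)" for x y
  proof -
    have "inner (\<i> *\<^sub>C T (x + \<i> *\<^sub>C y)) (x + \<i> *\<^sub>C y) = 0" by (rule im)
    then have "inner (\<i> *\<^sub>C T x) (\<i> *\<^sub>C y) + inner (\<i> *\<^sub>C \<i> *\<^sub>C T y) x = 0"
      using im[of x] im[of "\<i> *\<^sub>C y"]
      by (simp add: blinfun.bilinear_simps scaleC_add_right inner_add_left inner_add_right
          BH_scaleC[OF T])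
    then show ?thesis
      by (simp add: scaleC_scaleC scaleC_minus1 inner_commute)
        (simp add: inner_eq_Re_cinner cinner_scaleC_left cinner_scaleC_right)
  qed
  then show "psd T" using re by (simp add: psd_def self_adjoint_def)
next
  assume T: "T \<in> BH \<and> psd T"
  have "Im (cinner (T x) x) = 0" for x
  proof -
    have "inner (T (\<i> *\<^sub>C x)) x = inner (\<i> *\<^sub>C x) (T x)"
      using T by (simp add: self_adjointD psd_self_adjoint)
    also have "\<dots> = Re (cinner (T x) (\<i> *\<^sub>C x))"
      by (simp add: inner_commute flip: inner_eq_Re_cinner)
    finally show ?thesis
      using T by (simp add: BH_scaleC inner_eq_Re_cinner cinner_scaleC_left cinner_scaleC_right)
  qed
  then show "positive_op T"
    using T by (simp add: positive_op_def complex_nonneg_Reals_iff psd_nonneg flip: inner_eq_Re_cinner)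
qed

lemma le_op_iff: "S \<in> BH \<Longrightarrow> T \<in> BH \<Longrightarrow> self_adjoint S \<Longrightarrow> self_adjoint T \<Longrightarrow>
    S \<le>\<^sub>o\<^sub>p T \<longleftrightarrow> (\<forall>x. inner (S x) x \<le> inner (T x) x)"
  by (simp add: le_op_def positive_op_iff_psd BH_diff psd_def self_adjoint_diff
      blinfun.bilinear_simps inner_diff_left)

text \<open>
  Scalar multiplications as operators: membership in \<open>BH\<close> is then a commutation property, so the
  square root of an operator in \<open>BH\<close> inherits it from the commutant property.
\<close>

definition mulC :: "complex \<Rightarrow> ('a::complex_hilbert \<Rightarrow>\<^sub>L 'a)" where
  "mulC a = Blinfun (\<lambda>x. a *\<^sub>C x)"

lemma mulC_apply [simp]: "mulC a x = a *\<^sub>C x"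
proof -
  have "bounded_linear (\<lambda>x::'a. a *\<^sub>C x)"
    by (rule bounded_linear_intro[where K = "cmod a"])
      (simp_all add: scaleC_add_right scaleR_eq_scaleC scaleC_scaleC norm_scaleC mult.commute)
  then show ?thesis by (simp add: mulC_def bounded_linear_Blinfun_apply)
qed

lemma BH_iff_commute: "T \<in> BH \<longleftrightarrow> (\<forall>a. mulC a o\<^sub>L T = T o\<^sub>L mulC a)"
proof
  show "\<forall>a. mulC a o\<^sub>L T = T o\<^sub>L mulC a" if "T \<in> BH"
    using that by (auto intro!: blinfun_eqI simp: BH_scaleC)
  show "T \<in> BH" if comm: "\<forall>a. mulC a o\<^sub>L T = T o\<^sub>L mulC a"
    unfolding BH_def
  proof (intro CollectI allI)
    fix a x
    have "(T o\<^sub>L mulC a) x = (mulC a o\<^sub>L T) x" using comm by simp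
    then show "T (a *\<^sub>C x) = a *\<^sub>C T x" by simp
  qed
qed

section \<open>The modulus\<close>

lemma inner_adj_compose: "T \<in> BH \<Longrightarrow> inner ((adj T o\<^sub>L T) x) y = inner (T x) (T y)"
  by (simp add: inner_adj_left)

lemma abs_op_props:
  fixes T :: "'a::complex_hilbert \<Rightarrow>\<^sub>L 'a"
  assumes T: "T \<in> BH"
  shows "abs_op T \<in> BH" "psd (abs_op T)" "abs_op T o\<^sub>L abs_op T = adj T o\<^sub>L T"
    and "\<And>C. C o\<^sub>L (adj T o\<^sub>L T) = (adj T o\<^sub>L T) o\<^sub>L C \<Longrightarrow> C o\<^sub>L abs_op T = abs_op T o\<^sub>L C"
proof -
  let ?Q = "adj T o\<^sub>L T"
  have "psd ?Q"
    by (simp add: psd_def self_adjoint_def inner_adj_left[OF T] flip: inner_adj[OF T])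
  then obtain R where R: "psd R" "R o\<^sub>L R = ?Q" "\<And>C. C o\<^sub>L ?Q = ?Q o\<^sub>L C \<Longrightarrow> C o\<^sub>L R = R o\<^sub>L C"
    using psd_sqrt by blast
  have "R \<in> BH"
    using BH_compose[OF adj_in_BH[OF T] T] R(3) unfolding BH_iff_commute by blast
  have norm_root: "(norm (V x))\<^sup>2 = inner (?Q x) x" if "psd V" "V o\<^sub>L V = ?Q" for V x
    unfolding that(2)[symmetric]
    by (simp add: power2_norm_eq_inner self_adjointD[OF psd_self_adjoint[OF that(1)], of "V x" x])
  have eq: "abs_op T = R"
    unfolding abs_op_def
  proof (rule the_equality)
    show "positive_op R \<and> R o\<^sub>L R = ?Q" using R(1,2) \<open>R \<in> BH\<close> by (simp add: positive_op_iff_psd)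
    fix V assume "positive_op V \<and> V o\<^sub>L V = ?Q"
    then have V: "psd V" "V o\<^sub>L V = ?Q" by (auto simp: positive_op_iff_psd)
    have "norm (V x) = norm (R x)" for x
      using norm_root[OF V, of x] norm_root[OF R(1,2), of x]
      by (simp add: power2_eq_imp_eq)
    then show "V = R" by (rule psd_eqI[OF V(1) R(1)])
  qed
  show "abs_op T \<in> BH" "psd (abs_op T)" "abs_op T o\<^sub>L abs_op T = ?Q"
    unfolding eq by (fact \<open>R \<in> BH\<close> R(1,2))+
  show "C o\<^sub>L abs_op T = abs_op T o\<^sub>L C" if "C o\<^sub>L ?Q = ?Q o\<^sub>L C" for C
    unfolding eq using that by (rule R(3))
qed

lemma norm_abs_op:
  assumes T: "T \<in> BH"
  shows "norm (abs_op T x) = norm (T x)"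
proof -
  have "(norm (abs_op T x))\<^sup>2 = inner ((abs_op T o\<^sub>L abs_op T) x) x"
    by (simp add: power2_norm_eq_inner
        self_adjointD[OF psd_self_adjoint[OF abs_op_props(2)[OF T]], of "abs_op T x" x])
  also have "\<dots> = (norm (T x))\<^sup>2"
    unfolding abs_op_props(3)[OF T] inner_adj_compose[OF T] by (simp add: power2_norm_eq_inner)
  finally show ?thesis by (simp add: power2_eq_iff_nonneg)
qed

lemma normal_op_norm_adj:
  assumes "T \<in> BH" "normal_op T"
  shows "norm (adj T x) = norm (T x)"
proof -
  have "(norm (adj T x))\<^sup>2 = inner ((T o\<^sub>L adj T) x) x"
    by (simp add: power2_norm_eq_inner inner_adj[OF assms(1)])
  also have "\<dots> = (norm (T x))\<^sup>2"
    using assms by (simp add: normal_op_def inner_adj_left power2_norm_eq_inner)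
  finally show ?thesis by (simp add: power2_eq_iff_nonneg)
qed

lemma hyponormal_op_norm_adj:
  assumes T: "T \<in> BH" and "hyponormal_op T"
  shows "norm (adj T x) \<le> norm (T x)"
proof -
  have "0 \<le> inner (((adj T o\<^sub>L T) - (T o\<^sub>L adj T)) x) x"
    using assms(2) by (simp add: hyponormal_op_def le_op_def positive_op_iff_psd psd_nonneg)
  then have "(norm (adj T x))\<^sup>2 \<le> (norm (T x))\<^sup>2"
    by (simp add: blinfun.bilinear_simps inner_diff_left inner_adj[OF T] inner_adj_left[OF T]
        power2_norm_eq_inner)
  then show ?thesis by (simp add: power2_le_iff_abs_le)
qed

section \<open>Fuglede's theorem\<close>

text \<open>
  \<open>(1 + \<mu> D)\<^sup>n B (1 - \<mu> D)\<^sup>n\<close>, a polynomial in \<open>\<mu>\<close> with linear coefficient \<open>n (D B - B D)\<close>. It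
  approximates \<open>exp (\<lambda> D) B exp (- \<lambda> D)\<close> for \<open>\<lambda> = n \<mu>\<close>, the entire function to which
  Liouville's theorem is applied in Rosenblum's proof of Fuglede's theorem.
\<close>

primrec conj_poly :: "('a::complex_hilbert \<Rightarrow>\<^sub>L 'a) \<Rightarrow> ('a \<Rightarrow>\<^sub>L 'a) \<Rightarrow> nat \<Rightarrow> complex \<Rightarrow> ('a \<Rightarrow>\<^sub>L 'a)" where
  "conj_poly D B 0 \<mu> = B"
| "conj_poly D B (Suc n) \<mu> = (id_blinfun + (mulC \<mu> o\<^sub>L D)) o\<^sub>L conj_poly D B n \<mu> o\<^sub>L (id_blinfun - (mulC \<mu> o\<^sub>L D))"

lemma conj_poly_Suc_apply:
  "conj_poly D B (Suc n) \<mu> x =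
     conj_poly D B n \<mu> (x - \<mu> *\<^sub>C D x) + \<mu> *\<^sub>C D (conj_poly D B n \<mu> (x - \<mu> *\<^sub>C D x))"
  by (simp add: blinfun.bilinear_simps scaleC_diff_right)

lemma conj_poly_in_BH:
  assumes "D \<in> BH" "B \<in> BH"
  shows "conj_poly D B n \<mu> \<in> BH"
proof (induction n)
  case (Suc n)
  then show ?case
    by (auto simp: BH_def conj_poly_Suc_apply BH_scaleC[OF assms(1)] scaleC_add_right
        scaleC_diff_right scaleC_scaleC mult_ac blinfun.bilinear_simps simp del: conj_poly.simps)
qed (simp add: assms)

lemma conj_poly_commute:
  fixes A B D :: "'a::complex_hilbert \<Rightarrow>\<^sub>L 'a"
  assumes A: "A \<in> BH" and AD: "\<And>x. A (D x) = D (A x)" and AB: "\<And>x. A (B x) = B (A x)"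
  shows "A (conj_poly D B n \<mu> x) = conj_poly D B n \<mu> (A x)"
proof (induction n arbitrary: x)
  case (Suc n)
  then show ?case
    unfolding conj_poly_Suc_apply by (simp add: blinfun.bilinear_simps AD BH_scaleC[OF A])
qed (simp add: AB)

lemma norm_id_plus_skew_le:
  fixes K :: "'a::real_inner \<Rightarrow>\<^sub>L 'a"
  assumes skew: "\<And>x. inner (K x) x = 0"
  shows "norm (id_blinfun + K) \<le> sqrt (1 + (norm K)\<^sup>2)"
proof (rule norm_blinfun_bound)
  fix x
  have "(norm ((id_blinfun + K) x))\<^sup>2 = (norm x)\<^sup>2 + (norm (K x))\<^sup>2"
    using skew[of x]
    by (simp add: blinfun.bilinear_simps power2_norm_eq_inner inner_add_left inner_add_right inner_commute)
  also have "\<dots> \<le> (norm x)\<^sup>2 + (norm K * norm x)\<^sup>2"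
    by (intro add_left_mono power_mono norm_blinfun) simp
  also have "\<dots> = (sqrt (1 + (norm K)\<^sup>2) * norm x)\<^sup>2"
    by (simp add: power_mult_distrib real_sqrt_pow2 add_nonneg_nonneg distrib_right)
  finally show "norm ((id_blinfun + K) x) \<le> sqrt (1 + (norm K)\<^sup>2) * norm x"
    by (rule power2_le_imp_le) simp
qed simp

text \<open>
  The point is the absence of a term of first order in \<open>\<mu>\<close>. As \<open>X\<close> commutes with \<open>A\<close>, the operator
  \<open>L = \<mu> A\<^sup>*\<close> may be replaced in the first-order term \<open>L X - X L\<close> by \<open>K = L - L\<^sup>*\<close>. This \<open>K\<close> is
  skew, so \<open>1 + K\<close> and \<open>1 - K\<close> are isometries up to second order.
\<close>

lemma norm_conj_step_le:
  fixes A X :: "'a::complex_hilbert \<Rightarrow>\<^sub>L 'a" and \<mu> :: complex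
  assumes A: "A \<in> BH" and X: "X \<in> BH" and AX: "\<And>x. A (X x) = X (A x)"
  defines "L \<equiv> mulC \<mu> o\<^sub>L adj A"
  shows "norm ((id_blinfun + L) o\<^sub>L X o\<^sub>L (id_blinfun - L))
    \<le> (1 + 3 * ((norm A + norm (adj A)) * cmod \<mu>)\<^sup>2) * norm X"
proof -
  define L' where "L' = mulC (cnj \<mu>) o\<^sub>L A"
  define K where "K = L - L'"
  define k where "k = (norm A + norm (adj A)) * cmod \<mu>"
  have nm: "norm (mulC \<nu> o\<^sub>L T) \<le> cmod \<nu> * norm T" for \<nu> and T :: "'a \<Rightarrow>\<^sub>L 'a"
    by (intro norm_blinfun_bound) (auto simp: norm_scaleC mult.assoc intro!: mult_left_mono norm_blinfun)
  have L: "norm L \<le> k"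
    using nm[of \<mu> "adj A"] by (simp add: L_def k_def algebra_simps add_increasing)
  have K: "norm K \<le> k"
    using norm_triangle_ineq4[of L L'] nm[of \<mu> "adj A"] nm[of "cnj \<mu>" A]
    by (simp add: K_def L_def L'_def k_def algebra_simps)
  have k0: "k \<ge> 0" by (simp add: k_def)
  have skew: "inner (K x) x = 0" for x
  proof -
    have "inner (K x) x = Re (\<mu> * cinner x (A x)) - Re (cnj \<mu> * cinner (A x) x)"
      by (simp add: K_def L_def L'_def blinfun.bilinear_simps inner_eq_Re_cinner cinner_diff_left
          cinner_scaleC_left cinner_adj_left[OF A])
    also have "cnj \<mu> * cinner (A x) x = cnj (\<mu> * cinner x (A x))"
      by (simp add: cinner_commute[of "A x" x])
    finally show ?thesis by simp
  qed
  have skew': "inner ((- K) x) x = 0" for x using skew[of x] by (simp add: blinfun.bilinear_simps)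
  let ?s = "sqrt (1 + (norm K)\<^sup>2)"
  have L'X: "L' (X x) = X (L' x)" for x by (simp add: L'_def AX BH_scaleC[OF X])
  have "(id_blinfun + L) o\<^sub>L X o\<^sub>L (id_blinfun - L) =
      ((id_blinfun + K) o\<^sub>L X o\<^sub>L (id_blinfun + (- K))) + (K o\<^sub>L X o\<^sub>L K) - (L o\<^sub>L X o\<^sub>L L)"
    by (rule blinfun_eqI) (simp add: K_def blinfun.bilinear_simps L'X)
  also have "norm \<dots> \<le> norm ((id_blinfun + K) o\<^sub>L X o\<^sub>L (id_blinfun + (- K)))
      + norm (K o\<^sub>L X o\<^sub>L K) + norm (L o\<^sub>L X o\<^sub>L L)"
    by (meson norm_triangle_ineq norm_triangle_ineq4 order_trans add_right_mono)
  also have "\<dots> \<le> ?s * norm X * ?s + k * norm X * k + k * norm X * k"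
    using norm_id_plus_skew_le[OF skew] norm_id_plus_skew_le[OF skew'] K L
    by (intro add_mono norm_blinfun_compose_le) auto
  also have "?s * norm X * ?s = (1 + (norm K)\<^sup>2) * norm X"
    by (simp add: mult.commute mult.left_commute add_nonneg_nonneg flip: mult.assoc)
  also have "(1 + (norm K)\<^sup>2) * norm X + k * norm X * k + k * norm X * k
      \<le> (1 + k\<^sup>2) * norm X + k * norm X * k + k * norm X * k"
    using K by (intro add_right_mono mult_right_mono add_left_mono power_mono) auto
  also have "(1 + k\<^sup>2) * norm X + k * norm X * k + k * norm X * k = (1 + 3 * k\<^sup>2) * norm X"
    by (simp add: power2_eq_square algebra_simps)
  finally show ?thesis unfolding k_def .
qed

lemma norm_conj_poly_le:
  fixes A B :: "'a::complex_hilbert \<Rightarrow>\<^sub>L 'a"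
  assumes A: "A \<in> BH" and B: "B \<in> BH" and N: "normal_op A" and AB: "\<And>x. A (B x) = B (A x)"
  shows "norm (conj_poly (adj A) B n \<mu>)
    \<le> (1 + 3 * ((norm A + norm (adj A)) * cmod \<mu>)\<^sup>2) ^ n * norm B"
proof (induction n)
  case (Suc n)
  let ?c = "1 + 3 * ((norm A + norm (adj A)) * cmod \<mu>)\<^sup>2"
  have AD: "A (adj A x) = adj A (A x)" for x
    using N by (metis normal_op_def blinfun_apply_blinfun_compose)
  have "norm (conj_poly (adj A) B (Suc n) \<mu>) \<le> ?c * norm (conj_poly (adj A) B n \<mu>)"
    unfolding conj_poly.simps
    by (intro norm_conj_step_le A conj_poly_in_BH adj_in_BH B conj_poly_commute AD AB)
  also have "\<dots> \<le> ?c * (?c ^ n * norm B)"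
    by (intro mult_left_mono Suc.IH) simp
  finally show ?case by (simp add: mult.assoc)
qed simp

lemma cinner_conj_poly_Suc:
  assumes A: "A \<in> BH" and B: "B \<in> BH"
  shows "cinner (conj_poly (adj A) B (Suc n) \<mu> x) y =
      cinner (conj_poly (adj A) B n \<mu> x) y - \<mu> * cinner (conj_poly (adj A) B n \<mu> (adj A x)) y
      + \<mu> * cinner (conj_poly (adj A) B n \<mu> x) (A y)
      - \<mu> * \<mu> * cinner (conj_poly (adj A) B n \<mu> (adj A x)) (A y)"
  unfolding conj_poly_Suc_apply
  by (simp add: blinfun.bilinear_simps cinner_add_left cinner_diff_left cinner_scaleC_left
      cinner_adj_left[OF A] BH_scaleC[OF conj_poly_in_BH[OF adj_in_BH[OF A] B]] algebra_simps)

lemma conj_poly_holomorphic: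
  assumes "A \<in> BH" and "B \<in> BH"
  shows "(\<lambda>\<mu>. cinner (conj_poly (adj A) B n \<mu> x) y) holomorphic_on S"
proof (induction n arbitrary: x y)
  case (Suc n)
  show ?case
    unfolding cinner_conj_poly_Suc[OF assms] by (intro holomorphic_intros Suc.IH)
qed simp

lemma conj_poly_at_0: "conj_poly D B n 0 x = B x"
proof (induction n arbitrary: x)
  case (Suc n)
  have "0 *\<^sub>C z = 0" for z :: 'a using scaleR_eq_scaleC[of 0 z] by simp
  with Suc show ?case unfolding conj_poly_Suc_apply by simp
qed simp

lemma conj_poly_deriv_at_0:
  assumes A: "A \<in> BH" and B: "B \<in> BH"
  shows "((\<lambda>\<mu>. cinner (conj_poly (adj A) B n \<mu> x) y) has_field_derivative
      of_nat n * cinner (adj A (B x) - B (adj A x)) y) (at 0)"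
proof (induction n arbitrary: x y)
  case (Suc n)
  show ?case
    unfolding cinner_conj_poly_Suc[OF assms]
    by (rule derivative_eq_intros Suc.IH refl)+
      (simp add: conj_poly_at_0 cinner_diff_left cinner_adj_left[OF A] algebra_simps)
qed simp

text \<open>
  Let \<open>y = (A\<^sup>* B - B A\<^sup>*) x\<close>. The polynomial \<open>f \<mu> = cinner ((1 + \<mu> A\<^sup>*)\<^sup>n B (1 - \<mu> A\<^sup>*)\<^sup>n x) y\<close> has derivative
  \<open>n (norm y)\<^sup>2\<close> at \<open>0\<close>. On the circle of radius \<open>1 / m\<close> with \<open>n = m\<^sup>2\<close> each of the \<open>n\<close> steps multiplies
  the norm by \<open>1 + O(1 / n)\<close> at most, so \<open>f\<close> is bounded by a constant \<open>b\<close> independent of \<open>m\<close>. Cauchy's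
  estimate gives \<open>m\<^sup>2 (norm y)\<^sup>2 \<le> m b\<close> for all \<open>m\<close>, hence \<open>y = 0\<close>.
\<close>

theorem Fuglede:
  fixes A B :: "'a::complex_hilbert \<Rightarrow>\<^sub>L 'a"
  assumes A: "A \<in> BH" and B: "B \<in> BH" and N: "normal_op A" and AB: "A o\<^sub>L B = B o\<^sub>L A"
  shows "adj A o\<^sub>L B = B o\<^sub>L adj A"
proof (rule blinfun_eqI)
  fix x
  have AB': "A (B x) = B (A x)" for x using AB by (metis blinfun_apply_blinfun_compose)
  define y where "y = adj A (B x) - B (adj A x)"
  define M where "M = norm A + norm (adj A)"
  define b where "b = exp (3 * M\<^sup>2) * norm B * norm x * norm y"
  have bound: "real m * (norm y)\<^sup>2 \<le> b" if m: "m > 0" for m :: nat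
  proof -
    define n where "n = m\<^sup>2"
    have n: "n > 0" using m by (simp add: n_def)
    define f where "f \<mu> = cinner (conj_poly (adj A) B n \<mu> x) y" for \<mu>
    have hol: "f holomorphic_on S" for S
      unfolding f_def by (rule conj_poly_holomorphic[OF A B])
    have "deriv f 0 = of_nat n * cinner y y"
      unfolding f_def y_def by (rule DERIV_imp_deriv[OF conj_poly_deriv_at_0[OF A B]])
    then have "norm (deriv f 0) = real n * (norm y)\<^sup>2"
      by (simp add: cinner_self norm_mult norm_power)
    moreover have "norm ((deriv ^^ 1) f 0) \<le> fact 1 * b / (1 / real m) ^ 1"
    proof (rule Cauchy_inequality)
      show "f holomorphic_on ball 0 (1 / real m)" by (rule hol)
      show "continuous_on (cball 0 (1 / real m)) f" by (intro holomorphic_on_imp_continuous_on hol)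
      show "0 < 1 / real m" using m by simp
      fix \<mu> :: complex assume "norm (0 - \<mu>) = 1 / real m"
      then have \<mu>: "cmod \<mu> = 1 / real m" by simp
      have "cmod (f \<mu>) \<le> norm (conj_poly (adj A) B n \<mu> x) * norm y"
        unfolding f_def by (rule cmod_cinner_le)
      also have "\<dots> \<le> norm (conj_poly (adj A) B n \<mu>) * norm x * norm y"
        by (intro mult_right_mono norm_blinfun) simp
      also have "\<dots> \<le> (1 + 3 * (M * cmod \<mu>)\<^sup>2) ^ n * norm B * norm x * norm y"
        unfolding M_def by (intro mult_right_mono norm_conj_poly_le A B N AB') auto
      also have "3 * (M * cmod \<mu>)\<^sup>2 = 3 * M\<^sup>2 / real n"
        by (simp add: \<mu> n_def power_mult_distrib power_divide)
      also have "(1 + 3 * M\<^sup>2 / real n) ^ n * norm B * norm x * norm y \<le> b"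
        unfolding b_def using n
        by (intro mult_right_mono exp_ge_one_plus_x_over_n_power_n) (auto intro: order_trans[of _ 0])
      finally show "cmod (f \<mu>) \<le> b" .
    qed
    ultimately have "real m * (real m * (norm y)\<^sup>2) \<le> real m * b"
      by (simp add: n_def power2_eq_square mult_ac)
    then show ?thesis using m by simp
  qed
  have "y = 0"
  proof (rule ccontr)
    assume "y \<noteq> 0"
    then obtain m :: nat where "b < real m * (norm y)\<^sup>2"
      using reals_Archimedean3[of "(norm y)\<^sup>2"] by auto
    moreover have "b \<ge> 0" by (simp add: b_def)
    ultimately show False using bound[of m] by (cases "m = 0") auto
  qed
  then show "(adj A o\<^sub>L B) x = (B o\<^sub>L adj A) x" by (simp add: y_def)
qed

section \<open>Moduli of commuting operators\<close>

lemma blinfun_commuteD: "S o\<^sub>L T = T o\<^sub>L S \<Longrightarrow> S (T x) = T (S x)"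
  by (metis blinfun_apply_blinfun_compose)

lemma abs_op_commute:
  fixes S T :: "'a::complex_hilbert \<Rightarrow>\<^sub>L 'a"
  assumes T: "T \<in> BH" and 1: "S o\<^sub>L T = T o\<^sub>L S" and 2: "S o\<^sub>L adj T = adj T o\<^sub>L S"
  shows "S o\<^sub>L abs_op T = abs_op T o\<^sub>L S"
  using blinfun_commuteD[OF 1] blinfun_commuteD[OF 2]
  by (intro abs_op_props(4)[OF T] blinfun_eqI) simp

lemma commute_adj_both:
  fixes S T :: "'a::complex_hilbert \<Rightarrow>\<^sub>L 'a"
  assumes S: "S \<in> BH" and T: "T \<in> BH" and comm: "adj S o\<^sub>L T = T o\<^sub>L adj S"
  shows "S o\<^sub>L adj T = adj T o\<^sub>L S"
proof (rule blinfun_eqI)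
  fix y
  have "\<forall>x. inner x (S (adj T y)) = inner x (adj T (S y))"
    using blinfun_commuteD[OF comm] by (metis inner_adj[OF T] inner_adj_left[OF S])
  then show "(S o\<^sub>L adj T) y = (adj T o\<^sub>L S) y" by (simp add: vector_eq_ldot)
qed

text \<open>
  The operator \<open>N = A\<^sup>* B\<close> satisfies \<open>norm (N x) = norm (B (A x))\<close> by normality of \<open>A\<close> and
  \<open>norm (N\<^sup>* x) = norm (B\<^sup>* (A x)) \<le> norm (B (A x))\<close> by hyponormality of \<open>B\<close>. Fuglede's theorem makes
  \<open>|A|\<close> and \<open>|B|\<close> commute with each other and \<open>|B|\<close> commute with \<open>A\<close>, so \<open>M = |A| |B|\<close> is positive and
  \<open>norm (M x) = norm (B (A x))\<close>. Thus \<open>R = - (N + N\<^sup>*) / 2\<close> is dominated by \<open>M\<close> vectorwise in norm, and therefore in form.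
\<close>

lemma neg_inner_le_inner_abs_op:
  fixes A B :: "'a::complex_hilbert \<Rightarrow>\<^sub>L 'a"
  assumes A: "A \<in> BH" and B: "B \<in> BH" and comm: "A o\<^sub>L B = B o\<^sub>L A"
    and N: "normal_op A" and H: "hyponormal_op B"
  shows "- inner (A x) (B x) \<le> inner (abs_op A x) (abs_op B x)"
proof -
  have A'B: "adj A o\<^sub>L B = B o\<^sub>L adj A" by (rule Fuglede[OF A B N comm])
  have AB': "A o\<^sub>L adj B = adj B o\<^sub>L A" by (rule commute_adj_both[OF A B A'B])
  have A_absB: "A o\<^sub>L abs_op B = abs_op B o\<^sub>L A"
    by (rule abs_op_commute[OF B comm AB'])
  have BabsA: "B o\<^sub>L abs_op A = abs_op A o\<^sub>L B"
    by (rule abs_op_commute[OF A comm[symmetric] A'B[symmetric]])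
  have A'B': "adj A o\<^sub>L adj B = adj B o\<^sub>L adj A"
  proof (rule blinfun_eqI)
    fix y
    have "\<forall>x. inner x (adj A (adj B y)) = inner x (adj B (adj A y))"
      using blinfun_commuteD[OF comm] by (metis inner_adj[OF A] inner_adj[OF B])
    then show "(adj A o\<^sub>L adj B) y = (adj B o\<^sub>L adj A) y" by (simp add: vector_eq_ldot)
  qed
  have "adj A o\<^sub>L abs_op B = abs_op B o\<^sub>L adj A"
    by (rule abs_op_commute[OF B A'B A'B'])
  then have abs_comm: "abs_op A o\<^sub>L abs_op B = abs_op B o\<^sub>L abs_op A"
    using abs_op_commute[OF A A_absB[symmetric]] by simp
  define M where "M = abs_op A o\<^sub>L abs_op B"
  have "psd M"
    unfolding M_def by (intro psd_compose abs_op_props A B abs_comm)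
  have normM: "norm (M x) = norm (B (A x))" for x
    using blinfun_commuteD[OF A_absB, of x] by (simp add: M_def norm_abs_op A B)
  define R where "R = - (1/2) *\<^sub>R ((adj A o\<^sub>L B) + (adj B o\<^sub>L A))"
  have R_app: "R x = - (1/2) *\<^sub>R (adj A (B x) + adj B (A x))" for x
    by (simp add: R_def blinfun.bilinear_simps)
  have "self_adjoint R"
    unfolding self_adjoint_def R_app
    by (simp add: inner_add_left inner_add_right inner_adj_left[OF A] inner_adj_left[OF B]
        flip: inner_adj[OF A] inner_adj[OF B])
  moreover have "norm (R x) \<le> norm (M x)" for x
  proof -
    have "norm (adj A (B x) + adj B (A x)) \<le> norm (adj A (B x)) + norm (adj B (A x))"
      by (rule norm_triangle_ineq)
    also have "norm (adj A (B x)) = norm (B (A x))"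
      using blinfun_commuteD[OF comm, of x] by (simp add: normal_op_norm_adj[OF A N])
    also have "norm (adj B (A x)) \<le> norm (B (A x))"
      by (rule hyponormal_op_norm_adj[OF B H])
    finally show ?thesis by (simp add: R_app normM)
  qed
  ultimately have "inner (R x) x \<le> inner (M x) x"
    using \<open>psd M\<close> by (intro self_adjoint_le_psd)
  moreover have "inner (R x) x = - inner (A x) (B x)"
    by (simp add: R_app inner_add_left inner_adj_left[OF A] inner_adj_left[OF B]
        inner_commute[of "B x" "A x"])
  moreover have "inner (M x) x = inner (abs_op A x) (abs_op B x)"
    unfolding M_def using self_adjointD[OF psd_self_adjoint[OF abs_op_props(2)[OF A]], of "abs_op B x" x]
    by (simp add: inner_commute)
  ultimately show ?thesis by simp
qed

theorem corollary3p13: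
  fixes A B :: "'h::complex_hilbert \<Rightarrow>\<^sub>L 'h"
  assumes "A \<in> BH" and "B \<in> BH"
    and "A o\<^sub>L B = B o\<^sub>L A"
    and "normal_op A"
    and "hyponormal_op B"
  shows "abs_op (abs_op A - abs_op B) \<le>\<^sub>o\<^sub>p abs_op (A + B)"
proof -
  note A = assms(1) and B = assms(2)
  let ?D = "abs_op A - abs_op B"
  have D: "?D \<in> BH" and S: "A + B \<in> BH"
    by (intro BH_diff BH_add abs_op_props A B)+
  \<comment> \<open>The squares differ by \<open>2 * (inner (A x) (B x) + inner (|A| x) (|B| x))\<close>.\<close>
  have le: "norm (?D x) \<le> norm ((A + B) x)" for x
  proof -
    have "(norm (?D x))\<^sup>2 = (norm (abs_op A x))\<^sup>2 + (norm (abs_op B x))\<^sup>2 - 2 * inner (abs_op A x) (abs_op B x)"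
      by (simp add: blinfun.bilinear_simps power2_norm_eq_inner inner_diff_left inner_diff_right inner_commute)
    also have "\<dots> \<le> (norm (A x))\<^sup>2 + (norm (B x))\<^sup>2 + 2 * inner (A x) (B x)"
      using neg_inner_le_inner_abs_op[OF assms, of x] by (simp add: norm_abs_op A B)
    also have "\<dots> = (norm ((A + B) x))\<^sup>2"
      by (simp add: blinfun.bilinear_simps power2_norm_eq_inner inner_add_left inner_add_right inner_commute)
    finally show ?thesis by (rule power2_le_imp_le) simp
  qed
  have "inner (abs_op ?D x) x \<le> inner (abs_op (A + B) x) x" for x
    by (rule self_adjoint_le_psd[OF psd_self_adjoint]) (simp_all add: abs_op_props D S norm_abs_op le)
  then show ?thesis
    by (simp add: le_op_iff abs_op_props D S psd_self_adjoint)
qed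

end
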